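(* Let $\beta_1,\beta_2>0$ be real numbers with $2\beta_1-\beta_2\geq 2\sqrt{2}(e-1)$. Let $p$ be an analytic function in $\mathbb{D}$ with $p(0)=1$ and $$1+\beta_1 zp'(z)+\beta_2 z^2p''(z)\prec e^z.$$ Then $p(z)\prec 1+\sinh^{-1}z$.
   Context: $\mathbb{D}=\{z\in\mathbb{C}:|z|<1\}$. For functions $f,g$ analytic in $\mathbb{D}$, $f\prec g$ ($f$ is subordinate to $g$) means there is an analytic $w:\mathbb{D}\to\mathbb{C}$ with $w(0)=0$ and $|w(z)|\leq|z|$ such that $f(z)=g(w(z))$ for all $z\in\mathbb{D}$. $\sinh^{-1}z=\log(z+\sqrt{1+z^2})$ is the principal branch of the inverse hyperbolic sine, analytic on $\mathbb{D}$ with value $0$ at $0$. *)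

theory Defs
  imports "HOL-Complex_Analysis.Complex_Analysis"
begin

(* Meant for f and g analytic in the unit disc; only their values there matter. *)
definition subordinate :: "(complex \<Rightarrow> complex) \<Rightarrow> (complex \<Rightarrow> complex) \<Rightarrow> bool"
    (infix "\<prec>" 50) where
  "f \<prec> g \<longleftrightarrow>
     (\<exists>w. w analytic_on ball 0 1 \<and> w 0 = 0 \<and>
          (\<forall>z\<in>ball 0 1. norm (w z) \<le> norm z \<and> f z = g (w z)))"

(* The library's arsinh at type complex is the principal branch. *)
lemma arsinh_complex_eq: "arsinh (z::complex) = Ln (z + csqrt (1 + z\<^sup>2))"
  by (simp add: arsinh_def csqrt_conv_powr add.commute)

end

theory Submission
  imports Defs
begin

text \<open>
  With \<open>k = p'\<close>, the hypothesis bounds \<open>\<beta>\<^sub>1 k + \<beta>\<^sub>2 z k'\<close> by \<open>e - 1\<close>. Multiplied by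
  \<open>t\<^sup>a\<^sup>-\<^sup>1\<close>, where \<open>a = \<beta>\<^sub>1 / \<beta>\<^sub>2\<close>, this expression at \<open>t z\<close> is \<open>\<beta>\<^sub>2\<close> times the derivative of
  \<open>t\<^sup>a k (t z)\<close>, and integrating over \<open>0 \<le> t \<le> 1\<close> gives
  \<open>norm (p' z) \<le> (e - 1) / \<beta>\<^sub>1 \<le> 1 / sqrt 2\<close>. Hence \<open>norm (p z - 1) \<le> 1 / sqrt 2\<close>, a region on which
  \<open>norm cosh \<le> sqrt 2\<close> and on which \<open>arsinh\<close> inverts \<open>sinh\<close>. The function \<open>w = sinh (p - 1)\<close>
  therefore has derivative of norm at most 1, and it witnesses the subordination.
\<close>

text \<open>Along the segment from 0 to \<open>w\<close>, the derivative of
  \<open>exp (t *\<^sub>R w)\<close> is dominated in norm by that of the real function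
  \<open>exp (t * norm w)\<close>.\<close>

lemma norm_exp_minus_one_le:
  fixes w :: complex
  shows "norm (exp w - 1) \<le> exp (norm w) - 1"
proof -
  have "norm (exp (1 *\<^sub>R w) - exp (0 *\<^sub>R w)) \<le> exp (1 * norm w) - exp (0 * norm w)"
  proof (rule differentiable_bound_general)
    fix t :: real assume "0 < t" "t < 1"
    show "((\<lambda>t. exp (t *\<^sub>R w)) has_vector_derivative exp (t *\<^sub>R w) * w) (at t)"
      by (rule exp_scaleR_has_vector_derivative_right)
    show "((\<lambda>t. exp (t * norm w)) has_vector_derivative exp (t * norm w) * norm w) (at t)"
      unfolding has_real_derivative_iff_has_vector_derivative[symmetric]
      by (auto intro!: derivative_eq_intros)
    have "norm (exp (t *\<^sub>R w)) \<le> exp (t * norm w)"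
      using norm_exp[of "t *\<^sub>R w"] \<open>0 < t\<close> by simp
    then show "norm (exp (t *\<^sub>R w) * w) \<le> exp (t * norm w) * norm w"
      unfolding norm_mult by (rule mult_right_mono) simp
  qed (auto intro!: continuous_intros)
  then show ?thesis by simp
qed

text \<open>By convexity, \<open>exp\<close> lies below its chord over [0, 1]. A bound linear in
  \<open>norm w\<close> is what later allows a factor \<open>z\<close> to be cancelled.\<close>

lemma norm_exp_minus_one_le_linear:
  fixes w :: complex
  assumes "norm w \<le> 1"
  shows "norm (exp w - 1) \<le> (exp 1 - 1) * norm w"
proof -
  have "exp (norm w) \<le> (1 - norm w) * exp 0 + norm w * exp 1"
    using convex_onD[OF exp_convex, of "norm w" 0 1] assms by simp
  then have "exp (norm w) - 1 \<le> (exp 1 - 1) * norm w"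
    by (simp add: algebra_simps)
  then show ?thesis using norm_exp_minus_one_le[of w] by linarith
qed

text \<open>In this strip \<open>cosh z\<close> has positive real part, so it is the principal
  square root of \<open>1 + (sinh z)\<^sup>2\<close>; what remains is
  \<open>Ln (exp z)\<close>.\<close>

lemma arsinh_sinh_complex:
  fixes z :: complex
  assumes "\<bar>Im z\<bar> < pi / 2"
  shows "arsinh (sinh z) = z"
proof -
  have "Re (cosh z) = cosh (Re z) * cos (Im z)"
    by (simp add: cosh_def Re_exp algebra_simps)
  moreover have "cos (Im z) > 0" using assms by (intro cos_gt_zero_pi) auto
  ultimately have "Re (cosh z) > 0" by simp
  then have "csqrt (1 + (sinh z)\<^sup>2) = cosh z"
    using csqrt_square[of "cosh z"] by (simp add: cosh_square_eq add.commute)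
  then have "arsinh (sinh z) = Ln (exp z)"
    by (simp add: arsinh_complex_eq sinh_plus_cosh)
  also have "\<dots> = z" using assms pi_gt_zero by (intro Ln_exp) linarith+
  finally show ?thesis .
qed

lemma cosh_le_sqrt2:
  fixes x :: real
  assumes "\<bar>x\<bar> \<le> 1 / sqrt 2"
  shows "cosh x \<le> sqrt 2"
proof -
  have s: "sqrt 2 * sqrt 2 = 2" "7 / 5 \<le> sqrt 2" "sqrt 2 \<le> 29 / 20"
    by (simp, (rule real_le_rsqrt real_le_lsqrt; simp add: power2_eq_square)+)
  have i: "1 / sqrt 2 = sqrt 2 / 2" by (simp add: field_simps)
  have ab: "\<bar>x\<bar> \<le> sqrt 2 / 2" using assms i by simp
  have "\<bar>x\<bar>\<^sup>2 \<le> (sqrt 2 / 2)\<^sup>2" using ab by (intro power_mono) auto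
  then have "\<bar>x\<bar>\<^sup>2 \<le> 1 / 2" using s by (simp add: power2_eq_square)
  moreover have "exp \<bar>x\<bar> \<le> 1 + \<bar>x\<bar> + \<bar>x\<bar>\<^sup>2" using ab s by (intro exp_bound) auto
  \<comment> \<open>The quadratic bound is at most \<open>3 / 2 + sqrt 2 / 2\<close>, and
    \<open>sqrt 2 \<ge> 1\<close>.\<close>
  ultimately have u: "exp \<bar>x\<bar> \<le> 1 + sqrt 2" using ab s by linarith
  have l: "1 \<le> exp \<bar>x\<bar>" by simp
  \<comment> \<open>\<open>u + 1 / u \<le> 2 sqrt 2\<close> holds exactly between the roots \<open>sqrt 2 - 1\<close> and \<open>sqrt 2 + 1\<close>\<close>
  have "0 \<le> (1 + sqrt 2 - exp \<bar>x\<bar>) * (exp \<bar>x\<bar> - (sqrt 2 - 1))"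
    using u l s by (intro mult_nonneg_nonneg) linarith+
  then have "exp \<bar>x\<bar> * exp \<bar>x\<bar> + 1 \<le> 2 * sqrt 2 * exp \<bar>x\<bar>"
    using s by (simp add: algebra_simps)
  then have "exp \<bar>x\<bar> + exp (- \<bar>x\<bar>) \<le> 2 * sqrt 2"
    by (simp add: exp_minus field_simps)
  then have "cosh \<bar>x\<bar> \<le> sqrt 2" by (simp add: cosh_field_def)
  then show ?thesis by simp
qed

lemma norm_cosh_le:
  fixes z :: complex
  shows "norm (cosh z) \<le> cosh (Re z)"
proof -
  have "norm (cosh z) = norm (exp z + exp (- z)) / 2"
    by (simp add: cosh_field_def norm_divide)
  also have "\<dots> \<le> (exp (Re z) + exp (- Re z)) / 2"
    using norm_triangle_ineq[of "exp z" "exp (- z)"] by simp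
  finally show ?thesis by (simp add: cosh_field_def)
qed

text \<open>To be applied with \<open>k = deriv p\<close>. The bound is assumed only off 0 because
  there it arises by cancelling a factor \<open>z\<close>.\<close>

lemma first_order_euler_bound:
  fixes k :: "complex \<Rightarrow> complex" and a b M :: real
  assumes a: "a > 0" and b: "b > 0"
    and k: "k holomorphic_on ball 0 1"
    and bound: "\<And>z. z \<in> ball 0 1 \<Longrightarrow> z \<noteq> 0 \<Longrightarrow>
      norm (of_real a * k z + of_real b * z * deriv k z) \<le> M"
    and z: "z \<in> ball 0 1"
  shows "norm (k z) \<le> M / a"
proof -
  have nonzero: "norm (k z) \<le> M / a" if z: "z \<in> ball 0 1" "z \<noteq> 0" for z
  proof -
    define c where "c = a / b"
    have c: "c > 0" using a b by (simp add: c_def)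
    have ray: "t *\<^sub>R z \<in> ball 0 1" if "0 \<le> t" "t \<le> 1" for t
      using order_le_less_trans[OF mult_left_le_one_le[OF norm_ge_zero that], of z 1] that z
      by simp
    \<comment> \<open>A mean value inequality replaces the integral. The comparison function
      \<open>M / a * t powr c\<close> has derivative \<open>t powr (c - 1) / b * M\<close>, as
      \<open>c / a = 1 / b\<close>; the terms at \<open>t = 0\<close> vanish.\<close>
    have "norm ((1 powr c) *\<^sub>R k (1 *\<^sub>R z) - (0 powr c) *\<^sub>R k (0 *\<^sub>R z))
        \<le> M / a * 1 powr c - M / a * 0 powr c"
    proof (rule differentiable_bound_general)
      show "continuous_on {0..1} (\<lambda>t. (t powr c) *\<^sub>R k (t *\<^sub>R z))"
        using c ray by (intro continuous_intros continuous_on_compose2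
          [OF holomorphic_on_imp_continuous_on[OF k]] continuous_on_powr') auto
      show "continuous_on {0..1} (\<lambda>t. M / a * t powr c)"
        using c by (intro continuous_intros continuous_on_powr') auto
      fix t :: real assume t: "0 < t" "t < 1"
      have tz: "t *\<^sub>R z \<in> ball 0 1" using ray t by simp
      let ?H = "of_real a * k (t *\<^sub>R z) + of_real b * (t *\<^sub>R z) * deriv k (t *\<^sub>R z)"
      have dk: "((\<lambda>t. k (t *\<^sub>R z)) has_vector_derivative z * deriv k (t *\<^sub>R z)) (at t)"
      proof -
        have "((\<lambda>t. t *\<^sub>R z) has_vector_derivative z) (at t)"
          by (auto simp: has_vector_derivative_def intro!: derivative_eq_intros)
        from field_vector_diff_chain_at[of "\<lambda>t. t *\<^sub>R z", OF this
            holomorphic_derivI[OF k open_ball tz]]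
        show ?thesis by (simp add: o_def)
      qed
      have dt: "((\<lambda>t. t powr c) has_real_derivative c * t powr (c - 1)) (at t)"
        using t by (intro has_real_derivative_powr)
      have "((\<lambda>t. (t powr c) *\<^sub>R k (t *\<^sub>R z)) has_vector_derivative
          (t powr c) *\<^sub>R (z * deriv k (t *\<^sub>R z)) + (c * t powr (c - 1)) *\<^sub>R k (t *\<^sub>R z)) (at t)"
        by (rule has_vector_derivative_scaleR[OF dt dk])
      moreover have "(t powr c) *\<^sub>R (z * deriv k (t *\<^sub>R z)) + (c * t powr (c - 1)) *\<^sub>R k (t *\<^sub>R z)
          = (t powr (c - 1) / b) *\<^sub>R ?H"
      proof -
        have "t powr c = t * t powr (c - 1)" using t by (simp add: powr_mult_base)
        then show ?thesis using b
          by (simp add: c_def scaleR_conv_of_real field_simps)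
      qed
      ultimately show "((\<lambda>t. (t powr c) *\<^sub>R k (t *\<^sub>R z)) has_vector_derivative
          (t powr (c - 1) / b) *\<^sub>R ?H) (at t)"
        by simp
      show "((\<lambda>t. M / a * t powr c) has_vector_derivative M / a * (c * t powr (c - 1))) (at t)"
        unfolding has_real_derivative_iff_has_vector_derivative[symmetric]
        by (rule DERIV_cmult[OF dt])
      have "norm ?H \<le> M" using bound[OF tz] t z by simp
      then have "t powr (c - 1) / b * norm ?H \<le> t powr (c - 1) / b * M"
        using b by (intro mult_left_mono) auto
      then show "norm ((t powr (c - 1) / b) *\<^sub>R ?H) \<le> M / a * (c * t powr (c - 1))"
        unfolding norm_scaleR using a b by (simp add: c_def mult.commute)
    qed simp
    then show ?thesis using c by simp
  qed
  show ?thesis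
  proof (cases "z = 0")
    \<comment> \<open>The bound passes to the centre by continuity of \<open>k\<close>.\<close>
    case True
    have "isCont k 0"
      using holomorphic_on_imp_continuous_on[OF k] by (simp add: continuous_on_eq_continuous_at)
    then have "(k \<longlongrightarrow> k 0) (at 0)" by (simp add: isCont_def)
    moreover have "\<forall>\<^sub>F z in at 0. norm (k z) \<le> M / a"
      unfolding eventually_at by (rule exI[of _ 1]) (use nonzero in auto)
    ultimately show ?thesis
      unfolding True by (intro Lim_norm_ubound[of "at 0" k]) auto
  qed (use nonzero z in blast)
qed

theorem theorem3p7:
  fixes \<beta>\<^sub>1 \<beta>\<^sub>2 :: real and p :: "complex \<Rightarrow> complex"
  assumes "\<beta>\<^sub>1 > 0" and "\<beta>\<^sub>2 > 0"
    and "2 * \<beta>\<^sub>1 - \<beta>\<^sub>2 \<ge> 2 * sqrt 2 * (exp 1 - 1)"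
    and "p analytic_on ball 0 1" and "p 0 = 1"
    and "(\<lambda>z. 1 + of_real \<beta>\<^sub>1 * z * deriv p z + of_real \<beta>\<^sub>2 * z\<^sup>2 * deriv (deriv p) z) \<prec> (\<lambda>z. exp z)"
  shows "p \<prec> (\<lambda>z. 1 + arsinh z)"
proof -
  let ?D = "ball (0::complex) 1"
  have hol: "p holomorphic_on ?D" using assms(4) by (rule analytic_imp_holomorphic)
  obtain v where v: "\<And>z. z \<in> ?D \<Longrightarrow> norm (v z) \<le> norm z"
    "\<And>z. z \<in> ?D \<Longrightarrow>
      1 + of_real \<beta>\<^sub>1 * z * deriv p z + of_real \<beta>\<^sub>2 * z\<^sup>2 * deriv (deriv p) z = exp (v z)"
    using assms(6) unfolding subordinate_def by blast
  have H: "norm (of_real \<beta>\<^sub>1 * deriv p z + of_real \<beta>\<^sub>2 * z * deriv (deriv p) z) \<le> exp 1 - 1"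
    (is "norm ?H \<le> _") if z: "z \<in> ?D" "z \<noteq> 0" for z
  proof -
    \<comment> \<open>Both terms of the hypothesis after the constant 1 contain \<open>z\<close>;
      since \<open>norm (v z) \<le> norm z\<close>, the linear bound on \<open>exp - 1\<close>
      supplies a matching factor \<open>norm z\<close>.\<close>
    have "z * ?H = exp (v z) - 1"
      using v(2)[OF z(1)] by (simp add: algebra_simps power2_eq_square)
    then have "norm z * norm ?H = norm (exp (v z) - 1)" by (metis norm_mult)
    also have "\<dots> \<le> (exp 1 - 1) * norm (v z)"
      using v(1)[OF z(1)] z(1) by (intro norm_exp_minus_one_le_linear) auto
    also have "\<dots> \<le> (exp 1 - 1) * norm z"
      using v(1)[OF z(1)] by (intro mult_left_mono) auto
    finally show ?thesis using z(2) by simp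
  qed
  have "sqrt 2 * (exp 1 - 1) \<le> \<beta>\<^sub>1" using assms(2,3) by linarith
  then have M: "(exp 1 - 1) / \<beta>\<^sub>1 \<le> 1 / sqrt 2"
    using assms(1) by (simp add: field_simps)
  have dp: "norm (deriv p z) \<le> 1 / sqrt 2" if "z \<in> ?D" for z
    using first_order_euler_bound[OF assms(1,2) holomorphic_deriv[OF hol open_ball] H that] M
    by linarith
  have D: "(p has_field_derivative deriv p z) (at z within ?D)" if "z \<in> ?D" for z
    using holomorphic_derivI[OF hol open_ball that] by (rule has_field_derivative_at_within)
  have q: "norm (p z - 1) \<le> 1 / sqrt 2" if z: "z \<in> ?D" for z
  proof -
    have "norm (p z - p 0) \<le> 1 / sqrt 2 * norm (z - 0)"
      by (rule field_differentiable_bound[OF convex_ball D dp]) (use z in auto)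
    also have "\<dots> \<le> 1 / sqrt 2 * 1" using z by (intro mult_left_mono) auto
    finally show ?thesis using assms(5) by simp
  qed
  have Dw: "((\<lambda>z. sinh (p z - 1)) has_field_derivative cosh (p z - 1) * deriv p z) (at z within ?D)"
    if "z \<in> ?D" for z
    using D[OF that] by (auto intro!: derivative_eq_intros)
  \<comment> \<open>The bounds \<open>sqrt 2\<close> on \<open>cosh\<close> and
    \<open>1 / sqrt 2\<close> on \<open>deriv p\<close> multiply to exactly 1, which makes the
    witness satisfy \<open>norm (w z) \<le> norm z\<close>.\<close>
  have dw: "norm (cosh (p z - 1) * deriv p z) \<le> 1" if z: "z \<in> ?D" for z
  proof -
    have "\<bar>Re (p z - 1)\<bar> \<le> 1 / sqrt 2" using abs_Re_le_cmod[of "p z - 1"] q[OF z] by linarith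
    then have "norm (cosh (p z - 1)) \<le> sqrt 2"
      using norm_cosh_le[of "p z - 1"] cosh_le_sqrt2 by force
    then have "norm (cosh (p z - 1) * deriv p z) \<le> sqrt 2 * (1 / sqrt 2)"
      unfolding norm_mult using dp[OF z] by (intro mult_mono) auto
    then show ?thesis by simp
  qed
  show ?thesis
    unfolding subordinate_def
  proof (intro exI[of _ "\<lambda>z. sinh (p z - 1)"] conjI ballI)
    show "(\<lambda>z. sinh (p z - 1)) analytic_on ?D"
      unfolding analytic_on_open[OF open_ball] holomorphic_on_def field_differentiable_def
      using Dw by blast
    show "sinh (p 0 - 1) = 0" using assms(5) by simp
    fix z assume z: "z \<in> ?D"
    have "norm (sinh (p z - 1) - sinh (p 0 - 1)) \<le> 1 * norm (z - 0)"
      by (rule field_differentiable_bound[OF convex_ball Dw dw]) (use z in auto)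
    then show "norm (sinh (p z - 1)) \<le> norm z" using assms(5) by simp
    \<comment> \<open>As 1 < 3/2 < \<open>pi / 2\<close>, the values of \<open>p - 1\<close> stay in
      the strip where \<open>arsinh\<close> inverts \<open>sinh\<close>.\<close>
    have "1 / sqrt 2 \<le> 1" by simp
    then have "\<bar>Im (p z - 1)\<bar> < pi / 2"
      using abs_Im_le_cmod[of "p z - 1"] q[OF z] pi_gt3 by linarith
    then show "p z = 1 + arsinh (sinh (p z - 1))"
      by (simp add: arsinh_sinh_complex)
  qed
qed

end
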